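(* Let $P$ be a symmetric positive-definite real $n\times n$ matrix, $E=PB_2^n$ the corresponding ellipsoid, and $L\subset\mathbb{R}^n$ an arbitrary centrally symmetric convex body. Then $E$ is in positive John position with respect to $L$ if and only if $B_2^n$ is in positive John position with respect to $P^{-1}L$, i.e., $P^{-1}L$ is in Löwner position. In particular, all the bodies in the positive John family of $L$ inside $E$ have the same volume.
   Context: A convex body is a compact convex set with nonempty interior; $L$ is centrally symmetric if $L=-L$. $B_2^n$ is the Euclidean unit ball, $\mathcal{P}^n$ the set of symmetric positive-definite $n\times n$ matrices, $O_n$ the orthogonal group. A positive image of $L$ in $K$ is a set $QL+z\subset K$ with $Q\in\mathcal{P}^n$, $z\in\mathbb{R}^n$. $K$ is in positive John position with respect to $L$ if $L\subset K$ and $L$ has maximal volume among all positive images of $L$ contained in $K$. The positive John image of $L$ in $K$ is the unique positive image of $L$ in $K$ of maximal volume. The positive John family of $L$ in $K$ is the family of bodies, indexed by $U\in O_n$, consisting of the positive John image of $UL$ in $K$. A convex body is in Löwner position if the ellipsoid of minimal volume containing it is $B_2^n$. *)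

theory Defs
  imports "HOL-Analysis.Analysis"
begin

definition convex_body :: "(real ^ 'n) set \<Rightarrow> bool" where
  "convex_body K \<longleftrightarrow> compact K \<and> convex K \<and> interior K \<noteq> {}"

definition centrally_symmetric :: "(real ^ 'n) set \<Rightarrow> bool" where
  "centrally_symmetric L \<longleftrightarrow> L = uminus ` L"

definition sym_pos_def :: "real ^ 'n ^ 'n \<Rightarrow> bool" where
  "sym_pos_def Q \<longleftrightarrow> transpose Q = Q \<and> (\<forall>x. x \<noteq> 0 \<longrightarrow> x \<bullet> (Q *v x) > 0)"

definition positive_images :: "(real ^ 'n) set \<Rightarrow> (real ^ 'n) set \<Rightarrow> (real ^ 'n) set set" where
  "positive_images L K = {(\<lambda>x. Q *v x + z) ` L |Q z. sym_pos_def Q \<and> (\<lambda>x. Q *v x + z) ` L \<subseteq> K}"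

text \<open>The argument order follows the phrase ``\<open>K\<close> is in positive John position with respect to
  \<open>L\<close>'': the first argument is the outer body.\<close>

definition positive_John_position :: "(real ^ 'n) set \<Rightarrow> (real ^ 'n) set \<Rightarrow> bool" where
  "positive_John_position K L \<longleftrightarrow>
     L \<subseteq> K \<and> (\<forall>M \<in> positive_images L K. measure lebesgue M \<le> measure lebesgue L)"

text \<open>The maximizer exists and is unique whenever \<open>K\<close> and \<open>L\<close> are convex bodies, so the definite
  description is meaningful for them.\<close>

definition positive_John_image :: "(real ^ 'n) set \<Rightarrow> (real ^ 'n) set \<Rightarrow> (real ^ 'n) set" where
  "positive_John_image L K =
     (THE M. M \<in> positive_images L K \<and>
        (\<forall>M' \<in> positive_images L K. measure lebesgue M' \<le> measure lebesgue M))"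

definition positive_John_family :: "(real ^ 'n) set \<Rightarrow> (real ^ 'n) set \<Rightarrow> (real ^ 'n) set set" where
  "positive_John_family L K =
     (\<lambda>U. positive_John_image ((\<lambda>x. U *v x) ` L) K) ` {U. orthogonal_matrix U}"

text \<open>Nondegenerate ellipsoids with arbitrary centre.\<close>

definition ellipsoid :: "(real ^ 'n) set \<Rightarrow> bool" where
  "ellipsoid E \<longleftrightarrow> (\<exists>A z. invertible (A :: real ^ 'n ^ 'n) \<and> E = (\<lambda>x. A *v x + z) ` cball 0 1)"

text \<open>The strict inequality expresses that \<open>E\<close> is \<^emph>\<open>the\<close> ellipsoid of minimal volume
  containing \<open>L\<close>.\<close>

definition is_Loewner_ellipsoid :: "(real ^ 'n) set \<Rightarrow> (real ^ 'n) set \<Rightarrow> bool" where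
  "is_Loewner_ellipsoid E L \<longleftrightarrow>
     ellipsoid E \<and> L \<subseteq> E \<and>
     (\<forall>E'. ellipsoid E' \<and> L \<subseteq> E' \<and> E' \<noteq> E \<longrightarrow> measure lebesgue E < measure lebesgue E')"

definition Loewner_position :: "(real ^ 'n) set \<Rightarrow> bool" where
  "Loewner_position L \<longleftrightarrow> is_Loewner_ellipsoid (cball 0 1) L"

end

theory Submission
  imports Defs
begin

text \<open>Let \<open>E = P B\<close> with \<open>B\<close> the unit ball. For orthogonal \<open>U\<close> the matrix \<open>P U P\<^sup>-\<^sup>1\<close> maps \<open>E\<close> onto
  itself, and for every invertible \<open>A\<close> the polar decomposition of \<open>P\<^sup>-\<^sup>1 A P\<^sup>-\<^sup>1\<close> yields a \<open>U\<close> for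
  which \<open>P U P\<^sup>-\<^sup>1 A\<close> is positive definite. Hence the maximal volume of positive images of \<open>L\<close> in
  \<open>E\<close> equals that of all affine images. The latter problem is affinely invariant, does not see
  rotations of \<open>L\<close>, and for \<open>E = B\<close> is dual to the minimal ellipsoid problem. Uniqueness of the
  maximizer comes from strict log-concavity of the determinant and strict convexity of the ball.\<close>

subsection \<open>Volume of linear images\<close>

text \<open>The library has this only for index types of class \<open>wellorder\<close>.\<close>

lemma matrix_image_lmeasurable_measure:
  fixes A :: "real^'n^'n"
  assumes "S \<in> lmeasurable"
  shows lmeasurable_matrix_image: "(\<lambda>x. A *v x) ` S \<in> lmeasurable"
    and measure_matrix_image: "measure lebesgue ((\<lambda>x. A *v x) ` S) = \<bar>det A\<bar> * measure lebesgue S"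
proof -
  define scales :: "(real^'n \<Rightarrow> real^'n) \<Rightarrow> bool" where
    "scales f \<longleftrightarrow> (\<forall>S\<in>lmeasurable. f ` S \<in> lmeasurable \<and>
       measure lebesgue (f ` S) = \<bar>det (matrix f)\<bar> * measure lebesgue S)" for f
  \<comment> \<open>For linear maps with determinant of modulus 1, the claim for all measurable sets
    reduces to preserving the volume of boxes. Swaps and shears below are handled this way.\<close>
  have on_boxes: "scales f"
    if "linear f" and "\<bar>det (matrix f)\<bar> = 1"
      and "\<And>a b. cbox a b \<noteq> {} \<Longrightarrow> measure lebesgue (f ` cbox a b) = measure lebesgue (cbox a b)" for f
  proof -
    have "measure lebesgue (f ` cbox a b) = 1 * measure lebesgue (cbox a b)" for a b
      using that(3)[of a b] by (cases "cbox a b = {}") auto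
    then have "f ` S \<in> lmeasurable" "measure lebesgue (f ` S) = measure lebesgue S"
      if "S \<in> lmeasurable" for S
      using measure_linear_sufficient[OF \<open>linear f\<close> that, of 1] by auto
    then show ?thesis
      using that(2) by (simp add: scales_def)
  qed
  have "scales ((*v) A)"
  proof (rule induct_linear_elementary[of "(*v) A" scales])
    show "linear ((*v) A)" by simp
  next
    fix f g assume fg: "linear f" "linear g" "scales f" "scales g"
    have "(f \<circ> g) ` S \<in> lmeasurable \<and> measure lebesgue ((f \<circ> g) ` S) =
        \<bar>det (matrix (f \<circ> g))\<bar> * measure lebesgue S" if S: "S \<in> lmeasurable" for S
    proof -
      have gS: "g ` S \<in> lmeasurable" "measure lebesgue (g ` S) = \<bar>det (matrix g)\<bar> * measure lebesgue S"
        using fg(4) S unfolding scales_def by blast+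
      have "f ` g ` S \<in> lmeasurable"
        "measure lebesgue (f ` g ` S) = \<bar>det (matrix f)\<bar> * measure lebesgue (g ` S)"
        using fg(3) gS(1) unfolding scales_def by blast+
      then show ?thesis
        unfolding image_comp[symmetric] matrix_compose[OF fg(2,1)] det_mul abs_mult gS(2)
        by (simp add: mult.assoc)
    qed
    then show "scales (f \<circ> g)" by (simp add: scales_def)
  next
    \<comment> \<open>Singular case: \<open>f\<close> misses \<open>axis i 1\<close>, hence is
      neither surjective nor injective. Its determinant is zero and every image is negligible, so
      both sides vanish.\<close>
    fix f :: "real^'n \<Rightarrow> real^'n" and i assume f: "linear f" "\<And>x. f x $ i = 0"
    have "f x \<noteq> axis i 1" for x
      using f(2)[of x] by (metis axis_nth zero_neq_one)
    then have "\<not> inj f"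
      using linear_injective_imp_surjective[OF f(1)] by (metis surjD)
    moreover from this have "det (matrix f) = 0"
      using det_nz_iff_inj[OF f(1)] by blast
    moreover have "f ` S \<in> lmeasurable \<and> measure lebesgue (f ` S) = 0" for S
      using negligible_linear_singular_image[OF f(1) \<open>\<not> inj f\<close>]
      by (simp add: negligible_iff_measure)
    ultimately show "scales f" by (simp add: scales_def)
  next
    fix c
    have "matrix (\<lambda>x::real^'n. \<chi> i. c i * x $ i) = (\<chi> i j. if i = j then c i else 0)"
      by (simp add: matrix_def axis_def vec_eq_iff)
    then show "scales (\<lambda>x. \<chi> i. c i * x $ i)"
      by (simp add: scales_def measurable_stretch measure_stretch det_diagonal)
  next
    fix m n :: 'n assume "m \<noteq> n"
    let ?t = "Transposition.transpose m n"
    let ?h = "\<lambda>x::real^'n. \<chi> i. x $ ?t i"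
    have perm: "?t permutes UNIV" by (rule permutes_swap_id) auto
    have "matrix ?h = (\<chi> i. mat 1 $ ?t i)"
      by (auto simp: matrix_def axis_def mat_def vec_eq_iff)
    then have "\<bar>det (matrix ?h)\<bar> = 1"
      by (simp add: det_permute_rows[OF perm] sign_swap_id \<open>m \<noteq> n\<close>)
    moreover have "linear ?h"
      by (rule linearI) (simp_all add: vec_eq_iff)
    moreover have "measure lebesgue (?h ` cbox a b) = measure lebesgue (cbox a b)"
      if ne: "cbox a b \<noteq> {}" for a b
    proof -
      \<comment> \<open>The coordinate swap is an involution, so membership in the permuted box also
        yields the reverse inclusion.\<close>
      define h where "h = ?h"
      have inv: "h (h x) = x" for x by (simp add: h_def vec_eq_iff)
      have mem: "h x \<in> cbox (h a) (h b) \<longleftrightarrow> x \<in> cbox a b" for x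
        unfolding mem_box_cart h_def by (metis transpose_involutory vec_lambda_beta)
      have "h ` cbox a b = cbox (h a) (h b)"
      proof (intro equalityI subsetI)
        fix y assume "y \<in> cbox (h a) (h b)"
        then have "h y \<in> cbox a b" using mem[of "h y"] by (simp only: inv)
        then show "y \<in> h ` cbox a b" by (rule rev_image_eqI) (simp only: inv)
      qed (auto simp only: mem)
      then have im: "?h ` cbox a b = cbox (?h a) (?h b)" by (simp only: h_def)
      then have "cbox (?h a) (?h b) \<noteq> {}" using ne by blast
      then show ?thesis
        using ne prod.permute[OF perm, of "\<lambda>i. b $ i - a $ i"]
        by (simp add: im content_cbox_cart o_def)
    qed
    ultimately show "scales ?h" by (intro on_boxes)
  next
    fix m n :: 'n assume mn: "m \<noteq> n"
    let ?h = "\<lambda>x::real^'n. \<chi> i. if i = m then x $ m + x $ n else x $ i"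
    have lin: "linear ?h"
      by (rule linearI) (auto simp: vec_eq_iff algebra_simps)
    have "matrix ?h = (\<chi> k. if k = m then row m (mat 1) + 1 *s row n (mat 1) else row k (mat 1))"
      using mn by (auto simp: matrix_def axis_def mat_def row_def vec_eq_iff)
    then have "\<bar>det (matrix ?h)\<bar> = 1"
      by (simp only: det_row_operation[OF mn]) simp
    moreover have "measure lebesgue (?h ` cbox a b) = measure lebesgue (cbox a b)"
      if ne: "cbox a b \<noteq> {}" for a b
    proof -
      \<comment> \<open>The shear formula for boxes wants a lower corner with nonnegative
        \<open>n\<close>-th coordinate; translating that corner to the origin secures this, and
        linearity turns the translation into another translation.\<close>
      have box: "cbox a b = (+) a ` cbox 0 (b - a)"
        using cbox_translation[of a 0 "b - a"] by simp
      have "?h ` (+) a ` cbox 0 (b - a) = (+) (?h a) ` ?h ` cbox 0 (b - a)"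
        by (simp only: image_image linear_add[OF lin])
      then show ?thesis
        using measure_shear_interval[OF mn, of 0 "b - a"] ne
        by (simp only: box measure_translation) (simp add: box)
    qed
    ultimately show "scales ?h" using lin by (intro on_boxes)
  qed
  then show "(\<lambda>x. A *v x) ` S \<in> lmeasurable"
    and "measure lebesgue ((\<lambda>x. A *v x) ` S) = \<bar>det A\<bar> * measure lebesgue S"
    using assms by (auto simp: scales_def matrix_of_matrix_vector_mul)
qed

lemma measure_affine_image:
  fixes A :: "real^'n^'n"
  assumes "S \<in> lmeasurable"
  shows "measure lebesgue ((\<lambda>x. A *v x + z) ` S) = \<bar>det A\<bar> * measure lebesgue S"
proof -
  have "(\<lambda>x. A *v x + z) ` S = (+) z ` (\<lambda>x. A *v x) ` S"
    by (auto simp: image_image add.commute)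
  then show ?thesis
    by (simp add: measure_translation measure_matrix_image[OF assms])
qed

subsection \<open>Spectral theorem\<close>

text \<open>Rayleigh quotient argument: \<open>v\<close> maximizes the quadratic form on the unit
  sphere of \<open>W\<close>, the orthogonal complement of \<open>B\<close>. The bound on
  \<open>dim B\<close> makes that sphere nonempty, and \<open>W\<close> is invariant under
  \<open>A\<close> because \<open>B\<close> consists of eigenvectors and \<open>A\<close> is
  self-adjoint.\<close>

lemma symmetric_matrix_eigenvector:
  fixes A :: "real^'n^'n"
  assumes sym: "transpose A = A"
    and eig: "\<And>b. b \<in> B \<Longrightarrow> \<exists>l. A *v b = l *\<^sub>R b"
    and dim: "dim B < CARD('n)"
  obtains v l where "norm v = 1" "\<And>b. b \<in> B \<Longrightarrow> orthogonal v b" "A *v v = l *\<^sub>R v"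
proof -
  have selfadj: "x \<bullet> (A *v y) = (A *v x) \<bullet> y" for x y
    by (metis dot_lmul_matrix sym transpose_matrix_vector)
  define W where "W = {x. \<forall>b\<in>B. orthogonal x b}"
  have W_eq: "W = (\<Inter>b\<in>B. {x. b \<bullet> x = 0})"
    by (auto simp: W_def orthogonal_def inner_commute)
  have "closed W"
    unfolding W_eq by (intro closed_INT ballI closed_hyperplane)
  then have comp: "compact (W \<inter> sphere 0 1)"
    by (simp add: closed_Int_compact)
  have scaleW: "c *\<^sub>R x \<in> W" if "x \<in> W" for c x
    using that by (simp add: W_def orthogonal_def)
  obtain u where u: "u \<noteq> 0" "\<And>y. y \<in> span B \<Longrightarrow> orthogonal u y"
    using orthogonal_to_subspace_exists[of B] dim by auto
  have "u \<in> W" using u(2) by (simp add: W_def span_base)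
  then have "inverse (norm u) *\<^sub>R u \<in> W \<inter> sphere 0 1"
    using u(1) scaleW by simp
  then have "W \<inter> sphere 0 1 \<noteq> {}" by blast
  moreover have "continuous_on (W \<inter> sphere 0 1) (\<lambda>x. x \<bullet> (A *v x))"
    by (intro continuous_intros)
  ultimately obtain v where v: "v \<in> W" "norm v = 1"
    and vmax: "\<And>y. y \<in> W \<Longrightarrow> norm y = 1 \<Longrightarrow> y \<bullet> (A *v y) \<le> v \<bullet> (A *v v)"
    using continuous_attains_sup[OF comp] by force
  define l where "l = v \<bullet> (A *v v)"
  have quad: "y \<bullet> (A *v y) \<le> l * (y \<bullet> y)" if "y \<in> W" for y
  proof (cases "y = 0")
    case False
    then have "(inverse (norm y) *\<^sub>R y) \<bullet> (A *v (inverse (norm y) *\<^sub>R y)) \<le> l"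
      unfolding l_def using that by (intro vmax scaleW) auto
    then have "(y \<bullet> (A *v y)) / (norm y)\<^sup>2 \<le> l"
      by (simp add: matrix_vector_mult_scaleR power2_eq_square field_simps)
    then show ?thesis
      using False by (simp add: divide_le_eq power2_norm_eq_inner)
  qed simp
  \<comment> \<open>The residual of the eigenvalue equation. It lies in \<open>W\<close> and is
    orthogonal to \<open>v\<close>, so \<open>v + t w\<close> is an admissible perturbation.\<close>
  define w where "w = A *v v - l *\<^sub>R v"
  have vv: "v \<bullet> v = 1" using v(2) by (simp add: norm_eq_1)
  have "w \<in> W"
    unfolding W_def
  proof (intro CollectI ballI)
    fix b assume "b \<in> B"
    then obtain k where "A *v b = k *\<^sub>R b" using eig by blast
    moreover have "v \<bullet> b = 0" using v(1) \<open>b \<in> B\<close> by (simp add: W_def orthogonal_def)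
    ultimately show "orthogonal w b"
      using selfadj[of v b] by (simp add: w_def orthogonal_def inner_diff_left)
  qed
  have wv: "w \<bullet> v = 0" "v \<bullet> w = 0"
    using vv by (simp_all add: w_def l_def inner_diff_left inner_diff_right inner_commute)
  have wAv: "w \<bullet> (A *v v) = w \<bullet> w"
    using wv(1) inner_diff_right[of w "A *v v" "l *\<^sub>R v"] by (simp add: w_def[symmetric])
  \<comment> \<open>Evaluating \<open>quad\<close> at \<open>v + t w\<close>, the constant term
    \<open>l\<close> cancels and a linear term in \<open>t\<close> is bounded by a quadratic one,
    for every \<open>t\<close>.\<close>
  define c where "c = l * (w \<bullet> w) - w \<bullet> (A *v w)"
  have ineq: "2 * t * (w \<bullet> w) \<le> t\<^sup>2 * c" for t
  proof -
    have mem: "v + t *\<^sub>R w \<in> W"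
      using v(1) \<open>w \<in> W\<close> by (simp add: W_def orthogonal_def inner_add_left)
    have e1: "(v + t *\<^sub>R w) \<bullet> (A *v (v + t *\<^sub>R w)) = l + 2 * t * (w \<bullet> w) + t\<^sup>2 * (w \<bullet> (A *v w))"
    proof -
      have "v \<bullet> (A *v w) = w \<bullet> w"
        using selfadj[of v w] wAv by (metis inner_commute)
      then show ?thesis
        unfolding matrix_vector_right_distrib matrix_vector_mult_scaleR inner_add_left
          inner_add_right inner_scaleR_left inner_scaleR_right wAv l_def[symmetric]
        by (simp add: power2_eq_square distrib_left)
    qed
    have e2: "(v + t *\<^sub>R w) \<bullet> (v + t *\<^sub>R w) = 1 + t\<^sup>2 * (w \<bullet> w)"
      using wv vv by (simp add: inner_add_left inner_add_right power2_eq_square)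
    have "l + 2 * t * (w \<bullet> w) + t\<^sup>2 * (w \<bullet> (A *v w)) \<le> l * (1 + t\<^sup>2 * (w \<bullet> w))"
      using quad[OF mem] unfolding e1 e2 .
    then show ?thesis unfolding c_def by (simp add: algebra_simps)
  qed
  have "w = 0"
  proof (rule ccontr)
    assume "w \<noteq> 0"
    \<comment> \<open>Chosen so that \<open>t * (\<bar>c\<bar> + 1)\<close> equals
      \<open>w \<bullet> w\<close>, which gives 2|w|^2 \<le> |w|^2. The summand 1 keeps the
      denominator positive when \<open>c\<close> is zero.\<close>
    define t where "t = (w \<bullet> w) / (\<bar>c\<bar> + 1)"
    have "t > 0" using \<open>w \<noteq> 0\<close> by (simp add: t_def)
    then have "2 * (w \<bullet> w) \<le> t * c" using ineq[of t] by (simp add: power2_eq_square)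
    also have "\<dots> \<le> t * (\<bar>c\<bar> + 1)" using \<open>t > 0\<close> by simp
    also have "\<dots> = w \<bullet> w" by (simp add: t_def)
    finally show False using \<open>w \<noteq> 0\<close> by (simp add: not_le)
  qed
  then have "A *v v = l *\<^sub>R v" by (simp add: w_def)
  moreover have "\<And>b. b \<in> B \<Longrightarrow> orthogonal v b" using v(1) by (simp add: W_def)
  ultimately show thesis by (rule that[OF v(2), rotated])
qed

definition diag_matrix :: "('n \<Rightarrow> real) \<Rightarrow> real^'n^'n" where
  "diag_matrix d = (\<chi> i j. if i = j then d i else 0)"

lemma diag_matrix_mult_vec: "diag_matrix d *v x = (\<chi> i. d i * x $ i)"
  by (simp add: diag_matrix_def matrix_vector_mult_def vec_eq_iff if_distrib if_distribR cong: if_cong)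

lemma diag_matrix_mult: "diag_matrix d ** diag_matrix e = diag_matrix (\<lambda>i. d i * e i)"
  by (simp add: matrix_eq matrix_vector_mul_assoc[symmetric] diag_matrix_mult_vec vec_eq_iff)

lemma transpose_diag_matrix [simp]: "transpose (diag_matrix d) = diag_matrix d"
  by (auto simp: diag_matrix_def transpose_def vec_eq_iff)

lemma det_diag_matrix: "det (diag_matrix d) = prod d UNIV"
  by (simp add: diag_matrix_def det_diagonal)

text \<open>Induction on \<open>k\<close>: fewer than n eigenvectors span a proper subspace, so
  \<open>symmetric_matrix_eigenvector\<close> supplies one more unit eigenvector orthogonal to all
  of them.\<close>

lemma symmetric_matrix_orthonormal_eigenvectors:
  fixes A :: "real^'n^'n"
  assumes sym: "transpose A = A"
  shows "k \<le> CARD('n) \<Longrightarrow> \<exists>B. finite B \<and> card B = k \<and> pairwise orthogonal B \<and>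
    (\<forall>b\<in>B. norm b = 1 \<and> (\<exists>l. A *v b = l *\<^sub>R b))"
proof (induction k)
  case 0
  then show ?case by (intro exI[of _ "{}"]) simp
next
  case (Suc k)
  then obtain B where B: "finite B" "card B = k" "pairwise orthogonal B"
    "\<forall>b\<in>B. norm b = 1 \<and> (\<exists>l. A *v b = l *\<^sub>R b)" by auto
  have "dim B < CARD('n)" using dim_le_card'[OF B(1)] B(2) Suc.prems by simp
  then obtain v l where v: "norm v = 1" "\<And>b. b \<in> B \<Longrightarrow> orthogonal v b" "A *v v = l *\<^sub>R v"
    using symmetric_matrix_eigenvector[OF sym, of B] B(4) by metis
  have "v \<notin> B" using v(1,2) by (metis norm_zero orthogonal_self zero_neq_one)
  show ?case
  proof (intro exI conjI)
    show "finite (insert v B)" "card (insert v B) = Suc k"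
      using B(1,2) \<open>v \<notin> B\<close> by simp_all
    show "pairwise orthogonal (insert v B)"
      using B(3) v(2) by (simp add: pairwise_insert orthogonal_commute)
    show "\<forall>b\<in>insert v B. norm b = 1 \<and> (\<exists>l. A *v b = l *\<^sub>R b)"
      using B(4) v(1,3) by blast
  qed
qed

lemma symmetric_matrix_diagonalization:
  fixes A :: "real^'n^'n"
  assumes sym: "transpose A = A"
  obtains V d where "orthogonal_matrix V" "A = V ** diag_matrix d ** transpose V"
proof -
  obtain B where B: "finite B" "card B = CARD('n)" "pairwise orthogonal B"
    "\<forall>b\<in>B. norm b = 1 \<and> (\<exists>l. A *v b = l *\<^sub>R b)"
    using symmetric_matrix_orthonormal_eigenvectors[OF sym order_refl] by blast
  then obtain f where f: "bij_betw f (UNIV :: 'n set) B"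
    by (metis finite_class.finite_UNIV finite_same_card_bij)
  have fB: "f i \<in> B" for i using f by (auto simp: bij_betw_def)
  have "\<forall>i. \<exists>l. A *v f i = l *\<^sub>R f i" using B(4) fB by blast
  from choice[OF this] obtain d where d: "\<And>i. A *v f i = d i *\<^sub>R f i" by blast
  \<comment> \<open>The eigenbasis forms the columns of \<open>V\<close>, so the eigenvalue
    equations together say \<open>A ** V = V ** diag_matrix d\<close>.\<close>
  define V :: "real^'n^'n" where "V = (\<chi> i j. f j $ i)"
  have col: "column i V = f i" for i by (simp add: V_def column_def)
  have V: "orthogonal_matrix V"
    unfolding orthogonal_matrix_orthonormal_columns col
  proof (intro conjI allI impI)
    fix i j :: 'n assume "i \<noteq> j"
    then have "f i \<noteq> f j" using f by (metis UNIV_I bij_betw_inv_into_left)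
    then show "orthogonal (f i) (f j)" using B(3) fB by (simp add: pairwise_def)
  qed (use B(4) fB in blast)
  have "(A ** V) $ i $ j = (V ** diag_matrix d) $ i $ j" for i j
    using arg_cong[OF d[of j], of "\<lambda>x. x $ i"]
    by (simp add: matrix_matrix_mult_def matrix_vector_mult_def V_def diag_matrix_def
        if_distrib cong: if_cong)
  then have "A ** V = V ** diag_matrix d" by (simp add: vec_eq_iff)
  then have "A = V ** diag_matrix d ** transpose V"
    using V by (metis matrix_mul_assoc matrix_mul_rid orthogonal_matrix_def)
  with V that show thesis by blast
qed

subsection \<open>Positive definite matrices\<close>

lemma matrix_add_rdistrib:
  fixes A B :: "'a::semiring_1^'n^'m"
  shows "(A + B) ** C = A ** C + B ** C"
  by (simp add: matrix_matrix_mult_def vec_eq_iff distrib_right sum.distrib)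

lemma matrix_inv_inverse:
  fixes P :: "real^'n^'n"
  assumes "invertible P"
  shows matrix_inv_right: "P ** matrix_inv P = mat 1"
    and matrix_inv_left: "matrix_inv P ** P = mat 1"
  using someI_ex[OF assms[unfolded invertible_def]] by (simp_all add: matrix_inv_def)

lemma invertible_matrix_inv:
  fixes P :: "real^'n^'n"
  assumes "invertible P"
  shows "invertible (matrix_inv P)"
  using matrix_inv_inverse[OF assms] unfolding invertible_def by blast

lemma orthogonal_matrix_invertible:
  fixes U :: "real^'n^'n"
  assumes "orthogonal_matrix U"
  shows "invertible U"
  using assms unfolding orthogonal_matrix_def invertible_def by blast

lemma abs_det_orthogonal_matrix:
  fixes U :: "real^'n^'n"
  assumes "orthogonal_matrix U"
  shows "\<bar>det U\<bar> = 1"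
  using det_orthogonal_matrix[OF assms] by auto

lemma orthogonal_matrix_image_cball:
  fixes U :: "real^'n^'n"
  assumes "orthogonal_matrix U"
  shows "(\<lambda>x. U *v x) ` cball 0 r = cball 0 r"
proof -
  have "orthogonal_transformation ((*v) U)"
    using assms by (simp add: orthogonal_transformation_matrix matrix_of_matrix_vector_mul)
  then show ?thesis by (simp add: image_orthogonal_transformation_cball)
qed

lemma sym_pos_def_invertible:
  assumes "sym_pos_def A"
  shows "invertible A"
proof -
  have "inj ((*v) A)"
  proof (rule injI)
    fix x y assume "A *v x = A *v y"
    then have "A *v (x - y) = 0" by (simp add: matrix_vector_mult_diff_distrib)
    then have "(x - y) \<bullet> (A *v (x - y)) = 0" by simp
    then show "x = y"
      using assms unfolding sym_pos_def_def by (metis eq_iff_diff_eq_0 less_irrefl)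
  qed
  then show ?thesis
    by (simp add: invertible_left_inverse matrix_left_invertible_injective)
qed

lemma sym_pos_def_add:
  assumes "sym_pos_def A" "sym_pos_def B"
  shows "sym_pos_def (A + B)"
  unfolding sym_pos_def_def
proof (intro conjI allI impI)
  show "transpose (A + B) = A + B"
    using assms by (simp add: sym_pos_def_def transpose_def vec_eq_iff)
  show "0 < x \<bullet> ((A + B) *v x)" if "x \<noteq> 0" for x
    using assms that
    by (simp add: sym_pos_def_def matrix_vector_mult_add_rdistrib inner_add_right add_pos_pos)
qed

lemma sym_pos_def_scaleR:
  assumes "sym_pos_def A" "c > 0"
  shows "sym_pos_def (c *\<^sub>R A)"
  using assms
  by (simp add: sym_pos_def_def transpose_def vec_eq_iff scaleR_matrix_vector_assoc[symmetric])

lemma sym_pos_def_mat_1: "sym_pos_def (mat 1)"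
  by (simp add: sym_pos_def_def)

text \<open>The new quadratic form at \<open>x\<close> is the old one at \<open>C *v x\<close>,
  which is nonzero for \<open>x\<close> nonzero since \<open>C\<close> is injective.\<close>

lemma sym_pos_def_congruence:
  fixes A C :: "real^'n^'n"
  assumes "sym_pos_def A" "invertible C"
  shows "sym_pos_def (transpose C ** A ** C)"
  unfolding sym_pos_def_def
proof (intro conjI allI impI)
  show "transpose (transpose C ** A ** C) = transpose C ** A ** C"
    using assms(1) by (simp add: sym_pos_def_def matrix_transpose_mul matrix_mul_assoc)
  fix x :: "real^'n" assume "x \<noteq> 0"
  then have "C *v x \<noteq> 0"
    using inj_matrix_vector_mult[OF assms(2)] by (metis injD matrix_vector_mult_0_right)
  then have "0 < (C *v x) \<bullet> (A *v (C *v x))"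
    using assms(1) by (simp add: sym_pos_def_def)
  also have "\<dots> = x \<bullet> (transpose C *v (A *v (C *v x)))"
    by (metis dot_lmul_matrix inner_commute transpose_matrix_vector)
  finally show "0 < x \<bullet> ((transpose C ** A ** C) *v x)"
    by (simp only: matrix_vector_mul_assoc matrix_mul_assoc)
qed

lemma sym_pos_def_diag_matrix_iff:
  fixes d :: "'n::finite \<Rightarrow> real"
  shows "sym_pos_def (diag_matrix d) \<longleftrightarrow> (\<forall>i. d i > 0)"
proof
  assume "sym_pos_def (diag_matrix d)"
  then have "0 < axis i 1 \<bullet> (diag_matrix d *v axis i 1)" for i
    unfolding sym_pos_def_def by (metis axis_eq_0_iff zero_neq_one)
  then show "\<forall>i. d i > 0"
    by (simp add: diag_matrix_mult_vec inner_axis')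
next
  assume d: "\<forall>i. d i > 0"
  have "0 < (\<Sum>i\<in>UNIV. d i * (x $ i)\<^sup>2)" if "x \<noteq> 0" for x :: "real^'n"
  proof -
    have "\<exists>i. x $ i \<noteq> 0" using that by (simp add: vec_eq_iff)
    then obtain i where "x $ i \<noteq> 0" by blast
    then have "0 < d i * (x $ i)\<^sup>2" using d by simp
    then show ?thesis
      using d by (intro sum_pos2[where i=i]) (auto intro!: mult_nonneg_nonneg simp: less_imp_le)
  qed
  then show "sym_pos_def (diag_matrix d)"
    by (simp add: sym_pos_def_def diag_matrix_mult_vec inner_vec_def power2_eq_square mult.left_commute)
qed

lemma sym_pos_def_diagonalization:
  fixes A :: "real^'n^'n"
  assumes "sym_pos_def A"
  obtains V d where "orthogonal_matrix V" "A = V ** diag_matrix d ** transpose V" "\<And>i. d i > 0"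
proof -
  obtain V d where V: "orthogonal_matrix V" and A: "A = V ** diag_matrix d ** transpose V"
    using symmetric_matrix_diagonalization assms unfolding sym_pos_def_def by metis
  \<comment> \<open>Congruence by \<open>V\<close> isolates the diagonal factor, so positive
    definiteness of \<open>A\<close> passes to it and its entries are positive.\<close>
  have "transpose V ** A ** V = (transpose V ** V) ** diag_matrix d ** (transpose V ** V)"
    by (simp only: A matrix_mul_assoc)
  then have "sym_pos_def (diag_matrix d)"
    using sym_pos_def_congruence[OF assms orthogonal_matrix_invertible[OF V]] V
    by (simp add: orthogonal_matrix_def)
  then show thesis
    using that[OF V A] by (simp add: sym_pos_def_diag_matrix_iff)
qed

lemma det_orthogonal_congruence:
  fixes V A :: "real^'n^'n"
  assumes "orthogonal_matrix V"
  shows "det (V ** A ** transpose V) = det A"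
  using det_orthogonal_matrix[OF assms] by (auto simp: det_mul)

lemma sym_pos_def_det_pos:
  assumes "sym_pos_def A"
  shows "det A > 0"
proof -
  obtain V d where "orthogonal_matrix V" "A = V ** diag_matrix d ** transpose V" "\<And>i. d i > 0"
    using sym_pos_def_diagonalization[OF assms] by blast
  then show ?thesis
    by (simp add: det_orthogonal_congruence det_diag_matrix prod_pos)
qed

section \<open>Square roots and polar decomposition\<close>

text \<open>In an eigenbasis, replace each eigenvalue by its square root.\<close>

lemma sym_pos_def_sqrt:
  fixes A :: "real^'n^'n"
  assumes "sym_pos_def A"
  obtains R where "sym_pos_def R" "R ** R = A"
proof -
  obtain V d where V: "orthogonal_matrix V" and A: "A = V ** diag_matrix d ** transpose V"
    and d: "\<And>i. d i > 0"
    using sym_pos_def_diagonalization[OF assms] by blast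
  define D :: "real^'n^'n" where "D = diag_matrix (\<lambda>i. sqrt (d i))"
  have VT: "invertible (transpose V)"
    using V by (simp add: orthogonal_matrix_invertible)
  have "sym_pos_def (V ** D ** transpose V)"
    using sym_pos_def_congruence[OF _ VT, of D] d
    by (simp add: D_def sym_pos_def_diag_matrix_iff)
  moreover have "(V ** D ** transpose V) ** (V ** D ** transpose V)
      = V ** D ** (transpose V ** V) ** D ** transpose V"
    by (simp only: matrix_mul_assoc)
  moreover have "\<dots> = V ** (D ** D) ** transpose V"
    using V by (simp add: orthogonal_matrix_def matrix_mul_assoc)
  moreover have "D ** D = diag_matrix d"
    using d by (simp add: D_def diag_matrix_mult less_imp_le)
  ultimately show thesis
    using that A by metis
qed

text \<open>With \<open>R\<close> the positive square root of \<open>transpose A ** A\<close>, take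
  \<open>U = R ** matrix_inv A\<close>. Then \<open>U ** A = R\<close>, and
  \<open>transpose U ** U\<close> collapses to the identity because
  \<open>R ** R = transpose A ** A\<close>.\<close>

lemma polar_decomposition:
  fixes A :: "real^'n^'n"
  assumes "invertible A"
  obtains U where "orthogonal_matrix U" "sym_pos_def (U ** A)"
proof -
  have "sym_pos_def (transpose A ** A)"
    using sym_pos_def_congruence[OF sym_pos_def_mat_1 assms] by simp
  then obtain R where R: "sym_pos_def R" "R ** R = transpose A ** A"
    using sym_pos_def_sqrt by blast
  define B where "B = matrix_inv A"
  have AB: "A ** B = mat 1" "B ** A = mat 1"
    using matrix_inv_inverse[OF assms] by (simp_all add: B_def)
  have BA: "transpose B ** transpose A = mat 1"
    using AB(1) by (metis matrix_transpose_mul transpose_mat)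
  have RT: "transpose R = R" using R(1) by (simp add: sym_pos_def_def)
  have "transpose (R ** B) ** (R ** B) = transpose B ** (R ** R) ** B"
    by (simp add: matrix_transpose_mul RT matrix_mul_assoc)
  also have "\<dots> = (transpose B ** transpose A) ** (A ** B)"
    by (simp only: R(2) matrix_mul_assoc)
  also have "\<dots> = mat 1" by (simp add: AB BA)
  finally have "orthogonal_matrix (R ** B)" by (simp add: orthogonal_matrix)
  moreover have "R ** B ** A = R"
    using AB(2) by (metis matrix_mul_assoc matrix_mul_rid)
  ultimately show thesis using that[of "R ** B"] R(1) by simp
qed

section \<open>Strict log-concavity of the determinant\<close>

lemma det_scaleR:
  fixes A :: "real^'n^'n"
  shows "det (c *\<^sub>R A) = c ^ CARD('n) * det A"
proof -
  have "c *\<^sub>R A = diag_matrix (\<lambda>_. c) ** A"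
    by (simp add: matrix_eq matrix_vector_mul_assoc[symmetric] diag_matrix_mult_vec
        scaleR_matrix_vector_assoc[symmetric] vec_eq_iff)
  then show ?thesis by (simp add: det_mul det_diag_matrix)
qed

text \<open>In an eigenbasis of \<open>S\<close> the determinant of the average is the product of
  the means (1 + d_i)/2. Each mean is at least sqrt(d_i), strictly when d_i differs from 1, and the
  product of these roots is sqrt(det S) = 1.\<close>

lemma det_average_identity:
  fixes S :: "real^'n^'n"
  assumes S: "sym_pos_def S" "det S = 1" "S \<noteq> mat 1"
  shows "det ((1/2) *\<^sub>R (mat 1 + S)) > 1"
proof -
  obtain V d where V: "orthogonal_matrix V" and SV: "S = V ** diag_matrix d ** transpose V"
    and d: "\<And>i. d i > 0"
    using sym_pos_def_diagonalization[OF S(1)] by blast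
  have VV: "V ** transpose V = mat 1" using V by (simp add: orthogonal_matrix_def)
  have prod_d: "prod d UNIV = 1"
    using S(2) by (simp add: SV det_orthogonal_congruence[OF V] det_diag_matrix)
  have diag1: "diag_matrix (\<lambda>_. 1) = (mat 1 :: real^'n^'n)"
    by (simp add: diag_matrix_def mat_def)
  have "\<exists>j. d j \<noteq> 1"
  proof (rule ccontr)
    assume "\<not> ?thesis"
    then have "d = (\<lambda>_. 1)" by auto
    then show False using S(3) by (simp add: SV diag1 VV)
  qed
  then obtain j where j: "d j \<noteq> 1" by blast
  \<comment> \<open>The ratio of the arithmetic to the geometric mean of 1 and
    \<open>d i\<close>.\<close>
  define q where "q i = (1 + d i) / 2 / sqrt (d i)" for i
  have amgm: "1 + d i - 2 * sqrt (d i) = (sqrt (d i) - 1)\<^sup>2" for i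
    using d[of i] by (simp add: power2_diff)
  have "0 \<le> 1 + d i - 2 * sqrt (d i)" for i
    unfolding amgm by simp
  then have q1: "q i \<ge> 1" for i
    using d[of i] by (simp add: q_def le_divide_eq)
  have "sqrt (d j) \<noteq> 1" using j by simp
  then have "0 < 1 + d j - 2 * sqrt (d j)"
    unfolding amgm by simp
  then have qj: "q j > 1"
    using d[of j] by (simp add: q_def less_divide_eq)
  have "(1/2) *\<^sub>R (mat 1 + S) = V ** diag_matrix (\<lambda>i. (1 + d i) / 2) ** transpose V"
  proof -
    have "diag_matrix (\<lambda>i. (1 + d i) / 2) = (1/2) *\<^sub>R (mat 1 + diag_matrix d)"
      by (simp add: diag_matrix_def mat_def vec_eq_iff)
    then have "V ** diag_matrix (\<lambda>i. (1 + d i) / 2) ** transpose V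
        = (1/2) *\<^sub>R (V ** transpose V + V ** diag_matrix d ** transpose V)"
      by (simp add: matrix_scalar_ac scalar_matrix_assoc[symmetric] matrix_add_ldistrib
          matrix_add_rdistrib scaleR_add_right)
    then show ?thesis by (simp add: SV VV)
  qed
  then have "det ((1/2) *\<^sub>R (mat 1 + S)) = (\<Prod>i\<in>UNIV. (1 + d i) / 2)"
    by (simp add: det_orthogonal_congruence[OF V] det_diag_matrix)
  also have "\<dots> = (\<Prod>i\<in>UNIV. q i * sqrt (d i))"
    using d by (intro prod.cong refl) (simp add: q_def less_imp_neq[THEN not_sym])
  also have "\<dots> = prod q UNIV * sqrt (prod d UNIV)"
  proof -
    have "(\<Prod>i\<in>I. sqrt (d i)) = sqrt (prod d I)" for I
      by (induction I rule: infinite_finite_induct) (simp_all add: real_sqrt_mult)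
    then show ?thesis by (simp add: prod.distrib)
  qed
  also have "\<dots> = q j * prod q (UNIV - {j})"
    by (simp add: prod_d prod.remove)
  also have "\<dots> \<ge> q j * 1"
    using q1 qj by (intro mult_left_mono prod_ge_1) auto
  finally show ?thesis using qj by simp
qed

text \<open>Congruence by the inverse of the square root \<open>R\<close> of \<open>A\<close> sends
  \<open>A\<close> to the identity and \<open>B\<close> to a positive definite \<open>S\<close> of
  determinant 1, which reduces the claim to \<open>det_average_identity\<close>.\<close>

lemma det_average_strict:
  fixes A B :: "real^'n^'n"
  assumes A: "sym_pos_def A" and B: "sym_pos_def B" and det: "det A = det B" and "A \<noteq> B"
  shows "det ((1/2) *\<^sub>R (A + B)) > det A"
proof -
  obtain R where R: "sym_pos_def R" "R ** R = A" using sym_pos_def_sqrt[OF A] by blast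
  have RT: "transpose R = R" using R(1) by (simp add: sym_pos_def_def)
  define R' where "R' = matrix_inv R"
  have inv: "R ** R' = mat 1" "R' ** R = mat 1" "invertible R'"
    using matrix_inv_inverse invertible_matrix_inv sym_pos_def_invertible[OF R(1)]
    by (auto simp: R'_def)
  define S where "S = transpose R' ** B ** R'"
  have "R ** transpose R' = mat 1"
    using inv(2) by (metis RT matrix_transpose_mul transpose_mat)
  moreover have "R ** S ** R = (R ** transpose R') ** B ** (R' ** R)"
    by (simp only: S_def matrix_mul_assoc)
  ultimately have RSR: "R ** S ** R = B" by (simp add: inv)
  have S: "sym_pos_def S" unfolding S_def by (rule sym_pos_def_congruence[OF B inv(3)])
  have detR: "det R * det R = det A" using R(2) by (metis det_mul)
  have "det A * det S = det B"
    using RSR detR by (metis det_mul mult.commute mult.left_commute)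
  then have "det S = 1" using det sym_pos_def_det_pos[OF A] by simp
  moreover have "S \<noteq> mat 1" using RSR R(2) \<open>A \<noteq> B\<close> by auto
  ultimately have gt: "det ((1/2) *\<^sub>R (mat 1 + S)) > 1" by (intro det_average_identity S)
  have "(1/2) *\<^sub>R (A + B) = R ** ((1/2) *\<^sub>R (mat 1 + S)) ** R"
    using R(2) RSR
    by (simp add: matrix_scalar_ac scalar_matrix_assoc[symmetric] matrix_add_ldistrib
          matrix_add_rdistrib scaleR_add_right)
  then have "det ((1/2) *\<^sub>R (A + B)) = det A * det ((1/2) *\<^sub>R (mat 1 + S))"
    using detR by (simp add: det_mul mult_ac)
  then show ?thesis using gt sym_pos_def_det_pos[OF A] by simp
qed

subsection \<open>Positive and affine images in an ellipsoid\<close>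

lemma matrix_inv_mult_vec:
  fixes P :: "real^'n^'n"
  assumes "invertible P"
  shows "P *v (matrix_inv P *v x) = x" "matrix_inv P *v (P *v x) = x"
  by (simp_all add: matrix_vector_mul_assoc matrix_inv_inverse[OF assms])

lemma mem_matrix_image_iff:
  fixes P :: "real^'n^'n"
  assumes "invertible P"
  shows "x \<in> (\<lambda>x. P *v x) ` S \<longleftrightarrow> matrix_inv P *v x \<in> S"
  using matrix_inv_mult_vec[OF assms] by (metis (no_types, lifting) image_iff)

lemma convex_body_lmeasurable: "convex_body L \<Longrightarrow> L \<in> lmeasurable"
  by (simp add: convex_body_def lmeasurable_compact)

lemma convex_body_measure_pos:
  assumes "convex_body L"
  shows "0 < measure lebesgue L"
proof -
  have "\<not> negligible L"
    using assms unfolding convex_body_def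
    by (metis interior_subset negligible_subset open_interior open_not_negligible)
  then show ?thesis
    using convex_body_lmeasurable[OF assms] negligible_iff_measure
    by (metis measure_nonneg order_less_le)
qed

lemma convex_body_matrix_image:
  fixes A :: "real^'n^'n"
  assumes "convex_body L" "invertible A"
  shows "convex_body ((\<lambda>x. A *v x) ` L)"
proof -
  have inj: "inj ((*v) A)" by (rule inj_matrix_vector_mult[OF assms(2)])
  show ?thesis
    using assms(1) interior_injective_linear_image[OF _ inj, of L]
    by (auto simp: convex_body_def convex_linear_image
        intro!: compact_continuous_image matrix_vector_mult_linear_continuous_on)
qed

lemma measure_positive_image:
  assumes "L \<in> lmeasurable" "sym_pos_def Q"
  shows "measure lebesgue ((\<lambda>x. Q *v x + z) ` L) = det Q * measure lebesgue L"
  using measure_affine_image[OF assms(1), of Q z] sym_pos_def_det_pos[OF assms(2)] by simp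

text \<open>The matrices \<open>P ** U ** matrix_inv P\<close> with \<open>U\<close> orthogonal preserve the ellipsoid
  \<open>P B\<close>, so this turns every affine image inside it into a positive image of the same volume.\<close>

lemma positive_image_of_affine_image:
  fixes P A :: "real^'n^'n"
  assumes P: "sym_pos_def P" and A: "invertible A"
    and sub: "(\<lambda>x. A *v x + z) ` L \<subseteq> (\<lambda>x. P *v x) ` cball 0 1"
  obtains Q w where "sym_pos_def Q" "(\<lambda>x. Q *v x + w) ` L \<subseteq> (\<lambda>x. P *v x) ` cball 0 1"
    "det Q = \<bar>det A\<bar>"
proof -
  define R where "R = matrix_inv P"
  have Pinv: "invertible P" by (rule sym_pos_def_invertible[OF P])
  have RP: "R ** P = mat 1" "P ** R = mat 1" "invertible R"
    using matrix_inv_inverse[OF Pinv] invertible_matrix_inv[OF Pinv] by (simp_all add: R_def)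
  \<comment> \<open>The right factor \<open>R\<close> is there for the congruence by
    \<open>P\<close> that follows: it turns \<open>U ** (R ** A ** R)\<close> into
    \<open>P ** U ** R ** A\<close> and keeps positive definiteness.\<close>
  obtain U where U: "orthogonal_matrix U" "sym_pos_def (U ** (R ** A ** R))"
    using polar_decomposition[of "R ** A ** R"] A RP(3) by (metis invertible_mult)
  define T where "T = P ** U ** R"
  have "P ** (U ** (R ** A ** R)) ** P = T ** A ** (R ** P)"
    by (simp only: T_def matrix_mul_assoc)
  then have Q: "sym_pos_def (T ** A)"
    using sym_pos_def_congruence[OF U(2) Pinv] P by (simp add: RP sym_pos_def_def)
  have "det P * det R = 1" using RP(2) by (metis det_I det_mul)
  then have detT: "\<bar>det T\<bar> = 1"
    using abs_det_orthogonal_matrix[OF U(1)]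
    by (simp add: T_def det_mul abs_mult) (metis abs_mult abs_one)
  have T_ellipsoid: "T *v y \<in> (\<lambda>x. P *v x) ` cball 0 1" if "y \<in> (\<lambda>x. P *v x) ` cball 0 1" for y
  proof -
    have "R *v y \<in> cball 0 1" using that by (simp add: mem_matrix_image_iff[OF Pinv] R_def)
    then have "U *v (R *v y) \<in> cball 0 1"
      using orthogonal_matrix_image_cball[OF U(1)] by blast
    then show ?thesis by (auto simp: T_def matrix_vector_mul_assoc[symmetric])
  qed
  have eq: "(T ** A) *v x + T *v z = T *v (A *v x + z)" for x
    by (simp add: matrix_vector_right_distrib matrix_vector_mul_assoc)
  have "(\<lambda>x. (T ** A) *v x + T *v z) ` L \<subseteq> (\<lambda>x. P *v x) ` cball 0 1"
    unfolding eq using sub T_ellipsoid by blast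
  moreover have "det (T ** A) = \<bar>det A\<bar>"
    using sym_pos_def_det_pos[OF Q] detT by (metis abs_mult abs_of_pos det_mul mult_1)
  ultimately show thesis using that Q by blast
qed

section \<open>Maximality among affine images\<close>

text \<open>Competitors are all nondegenerate affine images, measured by determinants alone. Unlike
  the class of positive images, this class is stable under conjugation by an invertible matrix, so
  the notion can be transported from the ellipsoid to the ball.\<close>

definition affine_maximal :: "(real^'n) set \<Rightarrow> (real^'n) set \<Rightarrow> bool" where
  "affine_maximal L K \<longleftrightarrow>
     L \<subseteq> K \<and> (\<forall>A z. invertible A \<longrightarrow> (\<lambda>x. A *v x + z) ` L \<subseteq> K \<longrightarrow> \<bar>det A\<bar> \<le> 1)"

text \<open>An affine competitor can be replaced by a positive image with the same volume, so it
  cannot beat \<open>L\<close>; conversely positive images are affine competitors. Positive volume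
  of \<open>L\<close> allows cancelling it to compare determinants.\<close>

lemma positive_John_position_iff_affine_maximal:
  fixes P :: "real^'n^'n"
  assumes P: "sym_pos_def P" and L: "L \<in> lmeasurable" "0 < measure lebesgue L"
  shows "positive_John_position ((\<lambda>x. P *v x) ` cball 0 1) L \<longleftrightarrow>
    affine_maximal L ((\<lambda>x. P *v x) ` cball 0 1)" (is "?J \<longleftrightarrow> ?A")
proof
  assume J: ?J
  have "\<bar>det A\<bar> \<le> 1"
    if A: "invertible A" "(\<lambda>x. A *v x + z) ` L \<subseteq> (\<lambda>x. P *v x) ` cball 0 1" for A z
  proof -
    obtain Q w where Q: "sym_pos_def Q" "(\<lambda>x. Q *v x + w) ` L \<subseteq> (\<lambda>x. P *v x) ` cball 0 1"
      "det Q = \<bar>det A\<bar>"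
      using positive_image_of_affine_image[OF P A] by blast
    then have "(\<lambda>x. Q *v x + w) ` L \<in> positive_images L ((\<lambda>x. P *v x) ` cball 0 1)"
      unfolding positive_images_def by blast
    then have "det Q * measure lebesgue L \<le> measure lebesgue L"
      using J measure_positive_image[OF L(1) Q(1)] unfolding positive_John_position_def by metis
    then show ?thesis using L(2) Q(3) by simp
  qed
  then show ?A using J by (simp add: affine_maximal_def positive_John_position_def)
next
  assume A: ?A
  have "measure lebesgue M \<le> measure lebesgue L"
    if M: "M \<in> positive_images L ((\<lambda>x. P *v x) ` cball 0 1)" for M
  proof -
    obtain Q z where Q: "sym_pos_def Q" "M = (\<lambda>x. Q *v x + z) ` L"
      "(\<lambda>x. Q *v x + z) ` L \<subseteq> (\<lambda>x. P *v x) ` cball 0 1"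
      using M unfolding positive_images_def by blast
    then have "\<bar>det Q\<bar> \<le> 1"
      using A sym_pos_def_invertible[OF Q(1)] unfolding affine_maximal_def by blast
    then show ?thesis
      using L(2) by (simp add: Q(2) measure_positive_image[OF L(1) Q(1)] mult_left_le_one_le)
  qed
  then show ?J using A by (simp add: affine_maximal_def positive_John_position_def)
qed

text \<open>A competitor \<open>A\<close> for the transformed pair pulls back to
  \<open>matrix_inv C ** A ** C\<close>, which has the same determinant.\<close>

lemma affine_maximal_matrix_image:
  fixes C :: "real^'n^'n"
  assumes C: "invertible C" and max: "affine_maximal L K"
  shows "affine_maximal ((\<lambda>x. C *v x) ` L) ((\<lambda>x. C *v x) ` K)"
  unfolding affine_maximal_def
proof (intro conjI allI impI)
  show "(\<lambda>x. C *v x) ` L \<subseteq> (\<lambda>x. C *v x) ` K"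
    using max by (auto simp: affine_maximal_def)
  fix A z assume A: "invertible A"
    and sub: "(\<lambda>x. A *v x + z) ` (\<lambda>x. C *v x) ` L \<subseteq> (\<lambda>x. C *v x) ` K"
  define R where "R = matrix_inv C"
  have "(\<lambda>x. (R ** A ** C) *v x + R *v z) ` L \<subseteq> K"
  proof (rule image_subsetI)
    fix x assume "x \<in> L"
    then have "A *v (C *v x) + z \<in> (\<lambda>x. C *v x) ` K" using sub by blast
    then have "R *v (A *v (C *v x) + z) \<in> K" by (simp add: mem_matrix_image_iff[OF C] R_def)
    then show "(R ** A ** C) *v x + R *v z \<in> K"
      by (simp add: matrix_vector_right_distrib matrix_vector_mul_assoc matrix_mul_assoc)
  qed
  moreover have "invertible (R ** A ** C)"
    using A C invertible_matrix_inv[OF C] by (simp add: R_def invertible_mult)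
  ultimately have "\<bar>det (R ** A ** C)\<bar> \<le> 1"
    using max unfolding affine_maximal_def by blast
  moreover have "det R * det C = 1"
    using matrix_inv_left[OF C] unfolding R_def by (metis det_I det_mul)
  then have "det (R ** A ** C) = det A"
    by (simp add: det_mul)
  ultimately show "\<bar>det A\<bar> \<le> 1" by simp
qed

text \<open>Averaging two maximal positive images strictly increases the determinant unless the matrices
  agree; two distinct translates would leave room for a dilation, by the parallelogram law.\<close>

lemma maximal_positive_image_unique:
  fixes P :: "real^'n^'n"
  defines "E \<equiv> (\<lambda>x. P *v x) ` cball 0 1"
  assumes P: "invertible P"
    and Q1: "sym_pos_def Q1" "(\<lambda>x. Q1 *v x + z1) ` L \<subseteq> E" "det Q1 = m"
    and Q2: "sym_pos_def Q2" "(\<lambda>x. Q2 *v x + z2) ` L \<subseteq> E" "det Q2 = m"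
    and max: "\<And>Q z. sym_pos_def Q \<Longrightarrow> (\<lambda>x. Q *v x + z) ` L \<subseteq> E \<Longrightarrow> det Q \<le> m"
  shows "Q1 = Q2 \<and> z1 = z2"
proof -
  have "convex E" by (simp add: E_def convex_linear_image)
  define Q where "Q = (1/2) *\<^sub>R (Q1 + Q2)"
  define z where "z = (1/2) *\<^sub>R (z1 + z2)"
  have spd: "sym_pos_def Q"
    unfolding Q_def using Q1(1) Q2(1) by (intro sym_pos_def_scaleR sym_pos_def_add) simp_all
  have avg: "Q *v x + z = (1/2) *\<^sub>R (Q1 *v x + z1) + (1/2) *\<^sub>R (Q2 *v x + z2)" for x
    by (simp add: Q_def z_def scaleR_matrix_vector_assoc[symmetric] matrix_vector_mult_add_rdistrib
        algebra_simps)
  have "(\<lambda>x. Q *v x + z) ` L \<subseteq> E"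
    unfolding avg using Q1(2) Q2(2) by (intro image_subsetI convexD[OF \<open>convex E\<close>]) auto
  then have "det Q \<le> m" by (rule max[OF spd])
  then have Q12: "Q1 = Q2"
    using det_average_strict[OF Q1(1) Q2(1)] Q1(3) Q2(3) by (force simp: Q_def)
  have "z1 = z2"
  proof (rule ccontr)
    assume "z1 \<noteq> z2"
    define R where "R = matrix_inv P"
    have "inj ((*v) R)"
      unfolding R_def by (intro inj_matrix_vector_mult invertible_matrix_inv P)
    \<comment> \<open>Half the difference of the translations, in the coordinates in which
      \<open>E\<close> is the unit ball.\<close>
    define w where "w = R *v ((1/2) *\<^sub>R (z1 - z2))"
    have "w \<noteq> 0"
      using injD[OF \<open>inj ((*v) R)\<close>, of "(1/2) *\<^sub>R (z1 - z2)" 0] \<open>z1 \<noteq> z2\<close> by (auto simp: w_def)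
    \<comment> \<open>If \<open>a + w\<close> and \<open>a - w\<close> lie in the unit ball, then
      |a|^2 \<le> 1 - |w|^2, so |c a|^2 \<le> 1 - |w|^4 \<le> 1. Thus the midpoint image dilated by
      \<open>c > 1\<close> still fits, contradicting maximality of \<open>m\<close>.\<close>
    define c where "c = sqrt (1 + (norm w)\<^sup>2)"
    have c: "c > 1" "c\<^sup>2 = 1 + (norm w)\<^sup>2"
      using \<open>w \<noteq> 0\<close> by (simp_all add: c_def)
    have "(c *\<^sub>R Q1) *v x + c *\<^sub>R z \<in> E" if "x \<in> L" for x
    proof -
      define a where "a = R *v (Q1 *v x + z)"
      have "z1 = z + (1/2) *\<^sub>R (z1 - z2)" "z2 = z - (1/2) *\<^sub>R (z1 - z2)"
        by (simp_all add: z_def algebra_simps flip: scaleR_add_left)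
      then have "a + w = R *v (Q1 *v x + z1)" "a - w = R *v (Q2 *v x + z2)"
        unfolding a_def w_def Q12
        by (metis add.assoc matrix_vector_right_distrib,
            metis add_diff_eq matrix_vector_mult_diff_distrib)
      then have "a + w \<in> cball 0 1" "a - w \<in> cball 0 1"
        using Q1(2) Q2(2) that by (auto simp: E_def mem_matrix_image_iff[OF P] R_def image_subset_iff)
      then have "(norm (a + w))\<^sup>2 \<le> 1" "(norm (a - w))\<^sup>2 \<le> 1"
        by (simp_all add: power_le_one)
      then have aw: "(norm a)\<^sup>2 \<le> 1 - (norm w)\<^sup>2"
        unfolding power2_norm_eq_inner
        by (simp add: inner_add_left inner_add_right inner_diff_left inner_diff_right inner_commute)
      have "(c * norm a)\<^sup>2 = (1 + (norm w)\<^sup>2) * (norm a)\<^sup>2"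
        by (simp add: power_mult_distrib c(2))
      also have "\<dots> \<le> (1 + (norm w)\<^sup>2) * (1 - (norm w)\<^sup>2)"
        using aw by (intro mult_left_mono) auto
      also have "\<dots> = 1 - ((norm w)\<^sup>2)\<^sup>2" by (simp add: power2_eq_square algebra_simps)
      also have "\<dots> \<le> 1" by simp
      finally have "(c * norm a)\<^sup>2 \<le> 1" .
      then have "c * norm a \<le> 1" by (simp add: abs_square_le_1)
      then have "norm (c *\<^sub>R a) \<le> 1" using c(1) by simp
      moreover have "R *v ((c *\<^sub>R Q1) *v x + c *\<^sub>R z) = c *\<^sub>R a"
        by (simp add: a_def matrix_vector_right_distrib matrix_vector_mult_scaleR
            scaleR_matrix_vector_assoc[symmetric] scaleR_add_right)
      ultimately show ?thesis by (simp add: E_def mem_matrix_image_iff[OF P] R_def)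
    qed
    then have "det (c *\<^sub>R Q1) \<le> m"
      using c(1) Q1(1) by (intro max[where z="c *\<^sub>R z"] sym_pos_def_scaleR) auto
    moreover have "c ^ CARD('n) > 1" using c(1) by (intro one_less_power) auto
    moreover have "m > 0" using sym_pos_def_det_pos[OF Q1(1)] Q1(3) by simp
    ultimately show False using Q1(3) by (simp add: det_scaleR)
  qed
  with Q12 show ?thesis by simp
qed

section \<open>Duality with ellipsoids of minimal volume\<close>

text \<open>Inverting an affine map exchanges ellipsoids containing \<open>L\<close> with affine
  images of \<open>L\<close> inside the ball and inverts the determinant. The strict inequality for
  competing ellipsoids comes from uniqueness of the maximal positive image.\<close>

lemma Loewner_position_iff_affine_maximal:
  fixes L :: "(real^'n) set"
  shows "Loewner_position L \<longleftrightarrow> affine_maximal L (cball 0 1)" (is "?Loewner \<longleftrightarrow> ?max")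
proof -
  have ellipsoid_measure: "measure lebesgue ((\<lambda>x. A *v x + z) ` cball 0 1)
      = \<bar>det A\<bar> * measure lebesgue (cball (0::real^'n) 1)" for A :: "real^'n^'n" and z
    by (simp add: measure_affine_image lmeasurable_compact)
  have ball_pos: "0 < measure lebesgue (cball (0::real^'n) 1)" by simp
  have inverse_image: "(\<lambda>x. matrix_inv A *v x - matrix_inv A *v z) ` L \<subseteq> cball 0 1 \<longleftrightarrow>
      L \<subseteq> (\<lambda>x. A *v x + z) ` cball 0 1" if A: "invertible A" for A :: "real^'n^'n" and z
  proof -
    have "x \<in> (\<lambda>x. A *v x + z) ` cball 0 1 \<longleftrightarrow> matrix_inv A *v x - matrix_inv A *v z \<in> cball 0 1" for x
    proof -
      have "x \<in> (\<lambda>x. A *v x + z) ` cball 0 1 \<longleftrightarrow> x - z \<in> (\<lambda>x. A *v x) ` cball 0 1"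
        by (auto simp: image_iff algebra_simps)
      then show ?thesis
        unfolding mem_matrix_image_iff[OF A] matrix_vector_mult_diff_distrib .
    qed
    then show ?thesis by blast
  qed
  have det_inv: "1 \<le> \<bar>det (matrix_inv A)\<bar> \<longleftrightarrow> \<bar>det A\<bar> \<le> 1" if "invertible A" for A :: "real^'n^'n"
  proof -
    have "\<bar>det A\<bar> * \<bar>det (matrix_inv A)\<bar> = 1"
      by (simp add: matrix_inv_right[OF that] flip: abs_mult det_mul)
    from inverse_unique[OF this, symmetric] show ?thesis
      using that by (simp add: one_le_inverse_iff invertible_det_nz)
  qed
  show ?thesis
  proof
    assume Loewner: ?Loewner
    have "\<bar>det A\<bar> \<le> 1" if A: "invertible A" "(\<lambda>x. A *v x + z) ` L \<subseteq> cball 0 1" for A z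
    proof -
      define B where "B = matrix_inv A"
      have B: "invertible B" "matrix_inv B = A"
      proof -
        show "invertible B" unfolding B_def by (rule invertible_matrix_inv[OF A(1)])
        have "matrix_inv B = A ** (B ** matrix_inv B)"
          using matrix_inv_right[OF A(1)] by (simp add: B_def matrix_mul_assoc)
        then show "matrix_inv B = A" by (simp add: matrix_inv_right[OF \<open>invertible B\<close>])
      qed
      \<comment> \<open>The preimage of the unit ball under the map with matrix \<open>A\<close> and
        translation \<open>z\<close>, hence an ellipsoid around \<open>L\<close>.\<close>
      define E where "E = (\<lambda>x. B *v x + - (B *v z)) ` cball 0 1"
      have "A *v (- (B *v z)) = - z"
        using matrix_inv_mult_vec(1)[OF A(1), of "- z"]
        by (simp add: B_def linear_neg[OF matrix_vector_mul_linear])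
      then have "L \<subseteq> E"
        using inverse_image[OF B(1), of "- (B *v z)"] A(2) by (simp add: E_def B(2))
      moreover have "ellipsoid E" using B(1) unfolding ellipsoid_def E_def by blast
      ultimately have "measure lebesgue (cball (0::real^'n) 1) \<le> measure lebesgue E"
        using Loewner unfolding Loewner_position_def is_Loewner_ellipsoid_def
        by (metis order_refl less_imp_le)
      then have "1 * measure lebesgue (cball (0::real^'n) 1) \<le> \<bar>det B\<bar> * measure lebesgue (cball (0::real^'n) 1)"
        unfolding E_def ellipsoid_measure by simp
      then have "1 \<le> \<bar>det B\<bar>" using ball_pos by (rule mult_right_le_imp_le)
      then show ?thesis by (simp add: det_inv[OF A(1)] B_def)
    qed
    moreover have "L \<subseteq> cball 0 1"
      using Loewner by (simp add: Loewner_position_def is_Loewner_ellipsoid_def)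
    ultimately show ?max unfolding affine_maximal_def by blast
  next
    assume max: ?max
    have "measure lebesgue (cball (0::real^'n) 1) < measure lebesgue E"
      if E: "ellipsoid E" "L \<subseteq> E" "E \<noteq> cball 0 1" for E
    proof (rule ccontr)
      assume not_less: "\<not> ?thesis"
      obtain A :: "real^'n^'n" and z
        where A: "invertible A" and EA: "E = (\<lambda>x. A *v x + z) ` cball 0 1"
        using E(1) unfolding ellipsoid_def by blast
      define B where "B = matrix_inv A"
      define b where "b = - (B *v z)"
      have B: "invertible B" "(\<lambda>x. B *v x + b) ` L \<subseteq> cball 0 1"
        using invertible_matrix_inv[OF A] inverse_image[OF A, of z] E(2)
        by (simp_all add: B_def b_def EA)
      have "\<bar>det A\<bar> \<le> 1"
        using not_less ball_pos by (simp add: EA ellipsoid_measure)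
      then have "\<bar>det B\<bar> \<ge> 1"
        by (simp add: det_inv[OF A] B_def)
      then have detB: "\<bar>det B\<bar> = 1"
        using max B unfolding affine_maximal_def by (meson order_antisym)
      \<comment> \<open>Uniqueness concerns positive images only, so \<open>B\<close> is first
        rotated. This keeps the image in the ball and makes it a maximal positive image, to be
        compared with \<open>L\<close> itself, the image under the identity.\<close>
      obtain U where U: "orthogonal_matrix U" "sym_pos_def (U ** B)"
        using polar_decomposition[OF B(1)] by blast
      have UB: "(\<lambda>x. (U ** B) *v x + U *v b) ` L \<subseteq> (\<lambda>x. mat 1 *v x) ` cball 0 1"
      proof -
        have "(\<lambda>x. (U ** B) *v x + U *v b) ` L = (\<lambda>x. U *v x) ` (\<lambda>x. B *v x + b) ` L"
          by (simp add: image_image matrix_vector_right_distrib matrix_vector_mul_assoc)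
        also have "\<dots> \<subseteq> (\<lambda>x. U *v x) ` cball 0 1" using B(2) by (rule image_mono)
        finally show ?thesis by (simp add: orthogonal_matrix_image_cball[OF U(1)])
      qed
      have "det (U ** B) = 1"
        using sym_pos_def_det_pos[OF U(2)] abs_det_orthogonal_matrix[OF U(1)] detB
        by (metis abs_mult abs_of_pos det_mul mult_1)
      moreover have "det Q \<le> 1"
        if "sym_pos_def Q" "(\<lambda>x. Q *v x + w) ` L \<subseteq> (\<lambda>x. mat 1 *v x) ` cball 0 1" for Q w
      proof -
        have "(\<lambda>x. Q *v x + w) ` L \<subseteq> cball 0 1" using that(2) by simp
        then have "\<bar>det Q\<bar> \<le> 1"
          using max sym_pos_def_invertible[OF that(1)] unfolding affine_maximal_def by blast
        then show ?thesis by simp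
      qed
      moreover have "(\<lambda>x. mat 1 *v x + 0) ` L \<subseteq> (\<lambda>x. mat 1 *v x) ` cball 0 1"
        using max by (simp add: affine_maximal_def)
      ultimately have "U ** B = mat 1 \<and> U *v b = 0"
        using maximal_positive_image_unique[OF sym_pos_def_invertible[OF sym_pos_def_mat_1] U(2) UB _
            sym_pos_def_mat_1, where m=1 and ?z2.0=0]
        by simp
      moreover have "B *v z = - b" by (simp add: b_def)
      ultimately have "z = 0"
        using matrix_inv_mult_vec(1)[OF A, of z] inj_matrix_vector_mult[OF orthogonal_matrix_invertible[OF U(1)]]
        by (metis B_def injD matrix_vector_mult_0_right neg_0_equal_iff_equal)
      moreover have "A = U"
        using \<open>U ** B = mat 1 \<and> U *v b = 0\<close> matrix_inv_left[OF A] unfolding B_def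
        by (metis matrix_mul_assoc matrix_mul_lid matrix_mul_rid)
      ultimately have "E = cball 0 1"
        using orthogonal_matrix_image_cball[OF U(1)] by (simp add: EA)
      then show False using E(3) by simp
    qed
    moreover have "ellipsoid (cball (0::real^'n) 1)"
      unfolding ellipsoid_def by (intro exI[of _ "mat 1"] exI[of _ 0]) (simp add: invertible_det_nz)
    ultimately show ?Loewner
      using max unfolding Loewner_position_def is_Loewner_ellipsoid_def affine_maximal_def by blast
  qed
qed

section \<open>Existence and volume of maximal images\<close>

text \<open>The maps sending \<open>L\<close> into \<open>K\<close> form a compact set on which the
  modulus of the determinant is continuous. A small homothetic copy of \<open>L\<close> has positive
  determinant, so the maximizer is invertible.\<close>

lemma exists_maximal_affine_image:
  fixes K L :: "(real^'n) set"
  assumes K: "compact K" "interior K \<noteq> {}" and L: "bounded L" "interior L \<noteq> {}"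
  obtains A z where "invertible A" "(\<lambda>x. A *v x + z) ` L \<subseteq> K"
    "\<And>B w. (\<lambda>x. B *v x + w) ` L \<subseteq> K \<Longrightarrow> \<bar>det B\<bar> \<le> \<bar>det A\<bar>"
proof -
  obtain c r where r: "r > 0" "cball c r \<subseteq> L"
    using L(2) by (metis equals0I mem_interior_cball)
  have "c \<in> L" using r by auto
  obtain p e where e: "e > 0" "cball p e \<subseteq> K"
    using K(2) by (metis equals0I mem_interior_cball)
  obtain R where R: "\<And>x. x \<in> K \<Longrightarrow> norm x \<le> R"
    using compact_imp_bounded[OF K(1)] by (auto simp: bounded_iff)
  define C where "C = {q :: (real^'n^'n) \<times> (real^'n). \<forall>x\<in>L. fst q *v (x - c) + snd q \<in> K}"
  have shift: "(\<lambda>x. B *v x + w) ` L \<subseteq> K \<longleftrightarrow> (B, B *v c + w) \<in> C" for B w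
    by (auto simp: C_def matrix_vector_mult_diff_distrib)
  have cont: "continuous_on UNIV (\<lambda>q::(real^'n^'n) \<times> (real^'n). fst q *v y + snd q)" for y
  proof -
    have "linear (\<lambda>A::real^'n^'n. A *v y)"
      by (rule linearI) (simp_all add: matrix_vector_mult_add_rdistrib scaleR_matrix_vector_assoc)
    then have "bounded_linear (\<lambda>A::real^'n^'n. A *v y)" by (simp add: linear_conv_bounded_linear)
    then show ?thesis
      by (rule continuous_on_add[OF bounded_linear.continuous_on[OF _ continuous_on_fst[OF continuous_on_id]]
            continuous_on_snd[OF continuous_on_id]])
  qed
  have "closed C"
  proof -
    have "C = (\<Inter>x\<in>L. (\<lambda>q. fst q *v (x - c) + snd q) -` K)" by (auto simp: C_def)
    then show ?thesis
      using cont compact_imp_closed[OF K(1)] by (auto intro!: closed_INT closed_vimage simp: continuous_on_eq_continuous_at)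
  qed
  \<comment> \<open>Column \<open>j\<close> times \<open>r\<close> is the difference of the images
    of \<open>c + r *\<^sub>R axis j 1\<close> and \<open>c\<close>, two points of
    \<open>K\<close>.\<close>
  have bnd: "\<bar>A $ i $ j\<bar> \<le> 2 * R / r" if "(A, y) \<in> C" for A y i j
  proof -
    have "c + r *\<^sub>R axis j 1 \<in> L" using r by (intro subsetD[OF r(2)]) (simp add: dist_norm)
    then have "A *v (r *\<^sub>R axis j 1) + y \<in> K" using that by (force simp: C_def)
    moreover have "y \<in> K" using that \<open>c \<in> L\<close> by (force simp: C_def)
    ultimately have "norm (A *v (r *\<^sub>R axis j 1) + y - y) \<le> R + R"
      by (intro norm_triangle_le_diff add_mono R)
    then have "r * norm (A *v axis j 1) \<le> 2 * R"
      using r(1) by (simp add: matrix_vector_mult_scaleR)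
    moreover have "\<bar>A $ i $ j\<bar> \<le> norm (A *v axis j 1)"
      using component_le_norm_cart[of "A *v axis j 1" i] by (simp add: matrix_vector_mul_component inner_axis)
    ultimately show ?thesis
      using r(1) by (simp add: le_divide_eq mult.commute) (meson mult_left_mono less_imp_le order_trans)
  qed
  have "bounded C"
  proof (rule bounded_subset)
    define N where "N = (\<Sum>i\<in>(UNIV::'n set). \<Sum>j\<in>(UNIV::'n set). 2 * R / r)"
    show "bounded (cball (0::real^'n^'n) N \<times> K)"
      using compact_imp_bounded[OF K(1)] by (intro bounded_Times) simp_all
    show "C \<subseteq> cball 0 N \<times> K"
    proof (intro subsetI)
      fix q assume "q \<in> C"
      obtain A y where q: "q = (A, y)" by (cases q)
      have "norm A \<le> (\<Sum>i\<in>UNIV. norm (A $ i))"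
        unfolding norm_vec_def by (rule L2_set_le_sum) simp
      also have "\<dots> \<le> (\<Sum>i\<in>UNIV. \<Sum>j\<in>UNIV. \<bar>A $ i $ j\<bar>)"
        by (intro sum_mono norm_le_l1_cart)
      also have "\<dots> \<le> N"
        unfolding N_def using bnd \<open>q \<in> C\<close> q by (intro sum_mono) blast
      finally have "norm A \<le> N" .
      moreover have "y \<in> K" using \<open>q \<in> C\<close> \<open>c \<in> L\<close> q by (force simp: C_def)
      ultimately show "q \<in> cball 0 N \<times> K" by (simp add: q)
    qed
  qed
  have "compact C" using \<open>closed C\<close> \<open>bounded C\<close> by (simp add: compact_eq_bounded_closed)
  obtain D where D: "D > 0" "\<And>x. x \<in> L \<Longrightarrow> norm (x - c) \<le> D"
  proof -
    obtain D' where "\<And>x. x \<in> L \<Longrightarrow> norm x \<le> D'" using L(1) by (auto simp: bounded_iff)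
    then have "norm (x - c) \<le> \<bar>D'\<bar> + norm c + 1" if "x \<in> L" for x
      using norm_triangle_ineq4[of x c] that by (smt (verit))
    moreover have "0 < \<bar>D'\<bar> + norm c + 1" by (simp add: add_nonneg_pos)
    ultimately show thesis by (intro that)
  qed
  \<comment> \<open>Since \<open>L\<close> lies within distance \<open>D\<close> of
    \<open>c\<close>, scaling by \<open>e / D\<close> fits it into the ball of radius
    \<open>e\<close> around \<open>p\<close> in \<open>K\<close>.\<close>
  have small: "((e / D) *\<^sub>R mat 1, p) \<in> C"
  proof -
    have "(e / D) *\<^sub>R (x - c) + p \<in> K" if "x \<in> L" for x
    proof (rule subsetD[OF e(2)])
      have "norm ((e / D) *\<^sub>R (x - c)) = (e / D) * norm (x - c)"
        using D(1) e(1) by simp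
      also have "\<dots> \<le> (e / D) * D"
        using D(2)[OF that] D(1) e(1) by (intro mult_left_mono) simp_all
      finally show "(e / D) *\<^sub>R (x - c) + p \<in> cball p e"
        using D(1) by (simp add: dist_norm norm_minus_commute)
    qed
    then show ?thesis by (simp add: C_def scaleR_matrix_vector_assoc[symmetric])
  qed
  have "continuous_on C (\<lambda>q. \<bar>det (fst q)\<bar>)"
    unfolding det_def by (intro continuous_intros)
  then obtain q where q: "q \<in> C" "\<And>q'. q' \<in> C \<Longrightarrow> \<bar>det (fst q')\<bar> \<le> \<bar>det (fst q)\<bar>"
    using continuous_attains_sup[OF \<open>compact C\<close>] small by blast
  show thesis
  proof
    show "(\<lambda>x. fst q *v x + (snd q - fst q *v c)) ` L \<subseteq> K"
      using q(1) by (simp add: shift)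
    show "\<bar>det B\<bar> \<le> \<bar>det (fst q)\<bar>" if "(\<lambda>x. B *v x + w) ` L \<subseteq> K" for B w
      using q(2) that by (force simp: shift)
    have "0 < \<bar>det ((e / D) *\<^sub>R (mat 1 :: real^'n^'n))\<bar>"
      using e(1) D(1) by (simp add: det_scaleR)
    then have "det (fst q) \<noteq> 0" using q(2)[OF small] by auto
    then show "invertible (fst q)" by (simp add: invertible_det_nz)
  qed
qed

text \<open>The affine maximizer yields a positive image of equal determinant, which is therefore
  maximal. Its uniqueness evaluates the definite description in
  \<open>positive_John_image\<close>.\<close>

lemma measure_positive_John_image:
  fixes P :: "real^'n^'n"
  defines "E \<equiv> (\<lambda>x. P *v x) ` cball 0 1"
  assumes P: "sym_pos_def P" and L: "L \<in> lmeasurable" "0 < measure lebesgue L"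
    and A: "invertible A" "(\<lambda>x. A *v x + z) ` L \<subseteq> E"
    and max: "\<And>B w. (\<lambda>x. B *v x + w) ` L \<subseteq> E \<Longrightarrow> \<bar>det B\<bar> \<le> \<bar>det A\<bar>"
  shows "measure lebesgue (positive_John_image L E) = \<bar>det A\<bar> * measure lebesgue L"
proof -
  obtain Q w where Q: "sym_pos_def Q" "(\<lambda>x. Q *v x + w) ` L \<subseteq> E" "det Q = \<bar>det A\<bar>"
    using positive_image_of_affine_image[OF P A(1) A(2)[unfolded E_def]] unfolding E_def by blast
  have det_le: "det Q' \<le> \<bar>det A\<bar>" if "sym_pos_def Q'" "(\<lambda>x. Q' *v x + w') ` L \<subseteq> E" for Q' w'
    using max[OF that(2)] by simp
  define M where "M = (\<lambda>x. Q *v x + w) ` L"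
  have M_measure: "measure lebesgue M = \<bar>det A\<bar> * measure lebesgue L"
    by (simp add: M_def measure_positive_image[OF L(1) Q(1)] Q(3))
  have M_image: "M \<in> positive_images L E"
    using Q unfolding M_def positive_images_def by blast
  have M_max: "measure lebesgue M' \<le> measure lebesgue M" if M': "M' \<in> positive_images L E" for M'
  proof -
    obtain Q' w' where Q': "sym_pos_def Q'" "M' = (\<lambda>x. Q' *v x + w') ` L" "(\<lambda>x. Q' *v x + w') ` L \<subseteq> E"
      using M' unfolding positive_images_def by blast
    then show ?thesis
      using det_le L(2) by (simp add: M_measure measure_positive_image[OF L(1) Q'(1)])
  qed
  have "positive_John_image L E = M"
    unfolding positive_John_image_def
  proof (rule the_equality)
    fix M' assume M': "M' \<in> positive_images L E \<and>
      (\<forall>N\<in>positive_images L E. measure lebesgue N \<le> measure lebesgue M')"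
    then obtain Q' w' where Q': "sym_pos_def Q'" "M' = (\<lambda>x. Q' *v x + w') ` L"
      "(\<lambda>x. Q' *v x + w') ` L \<subseteq> E"
      by (auto simp: positive_images_def)
    have "measure lebesgue M' = measure lebesgue M"
      using M' M_image M_max by (meson order_antisym)
    then have "det Q' = \<bar>det A\<bar>"
      using L(2) by (simp add: M_measure Q'(2) measure_positive_image[OF L(1) Q'(1)])
    then have "Q' = Q \<and> w' = w"
      using maximal_positive_image_unique[OF sym_pos_def_invertible[OF P], folded E_def,
          OF Q'(1,3) _ Q] det_le by blast
    then show "M' = M" by (simp add: Q'(2) M_def)
  qed (use M_image M_max in blast)
  then show ?thesis by (simp add: M_measure)
qed

theorem proposition5p1:
  fixes P :: "real ^ 'n ^ 'n" and E L :: "(real ^ 'n) set"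
  assumes "sym_pos_def P"
    and "E = (\<lambda>x. P *v x) ` cball 0 1"
    and "convex_body L"
    and "centrally_symmetric L"
  shows "(positive_John_position E L \<longleftrightarrow>
            positive_John_position (cball 0 1) ((\<lambda>x. matrix_inv P *v x) ` L)) \<and>
         (positive_John_position (cball 0 1) ((\<lambda>x. matrix_inv P *v x) ` L) \<longleftrightarrow>
            Loewner_position ((\<lambda>x. matrix_inv P *v x) ` L)) \<and>
         (\<forall>M \<in> positive_John_family L E. \<forall>N \<in> positive_John_family L E.
            measure lebesgue M = measure lebesgue N)"
proof -
  note E = assms(2)
  have P: "invertible P" by (rule sym_pos_def_invertible[OF assms(1)])
  have R: "invertible (matrix_inv P)" by (rule invertible_matrix_inv[OF P])
  let ?L' = "(\<lambda>x. matrix_inv P *v x) ` L"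
  note L = convex_body_lmeasurable[OF assms(3)] convex_body_measure_pos[OF assms(3)]
  have L'_body: "convex_body ?L'" by (rule convex_body_matrix_image[OF assms(3) R])
  note L' = convex_body_lmeasurable[OF L'_body] convex_body_measure_pos[OF L'_body]
  have L_eq: "(\<lambda>x. P *v x) ` ?L' = L" and ball_eq: "(\<lambda>x. matrix_inv P *v x) ` E = cball 0 1"
    unfolding E image_image matrix_inv_mult_vec[OF P] by simp_all
  \<comment> \<open>Affine maximality is the bridge between \<open>E\<close> and the ball: it is
    carried by \<open>matrix_inv P\<close> in one direction and by \<open>P\<close> in the other,
    while conjugating a positive definite matrix by \<open>P\<close> need not leave it
    symmetric.\<close>
  have "positive_John_position E L \<longleftrightarrow> affine_maximal L E"
    unfolding E by (rule positive_John_position_iff_affine_maximal[OF assms(1) L])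
  also have "\<dots> \<longleftrightarrow> affine_maximal ?L' (cball 0 1)"
    using affine_maximal_matrix_image[OF R, of L E] affine_maximal_matrix_image[OF P, of ?L' "cball 0 1"]
    unfolding ball_eq L_eq E[symmetric] by blast
  finally have 1: "positive_John_position E L \<longleftrightarrow> affine_maximal ?L' (cball 0 1)" .
  have 2: "positive_John_position (cball 0 1) ?L' \<longleftrightarrow> affine_maximal ?L' (cball 0 1)"
    using positive_John_position_iff_affine_maximal[OF sym_pos_def_mat_1 L'] by simp

  \<comment> \<open>A single affine maximizer \<open>A\<close> for \<open>L\<close> determines the
    volume of every member of the family.\<close>
  have "0 \<in> interior (cball (0::real^'n) 1)" by simp
  then have "interior E \<noteq> {}"
    unfolding E
    using interior_injective_linear_image[OF matrix_vector_mul_linear inj_matrix_vector_mult[OF P], of "cball 0 1"]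
    by auto
  moreover have "compact E"
    unfolding E by (intro compact_continuous_image matrix_vector_mult_linear_continuous_on compact_cball)
  ultimately obtain A z where A: "invertible A" "(\<lambda>x. A *v x + z) ` L \<subseteq> E"
    and max: "\<And>B w. (\<lambda>x. B *v x + w) ` L \<subseteq> E \<Longrightarrow> \<bar>det B\<bar> \<le> \<bar>det A\<bar>"
    using exists_maximal_affine_image[of E L] assms(3) unfolding convex_body_def
    by (metis compact_imp_bounded)
  have 3: "measure lebesgue M = \<bar>det A\<bar> * measure lebesgue L" if family: "M \<in> positive_John_family L E" for M
  proof -
    obtain U where U: "orthogonal_matrix U"
      and M: "M = positive_John_image ((\<lambda>x. U *v x) ` L) E"
      using family unfolding positive_John_family_def by blast
    note Uinv = orthogonal_matrix_invertible[OF U]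
    have UL_measure: "measure lebesgue ((\<lambda>x. U *v x) ` L) = measure lebesgue L"
      using measure_matrix_image[OF L(1), of U] abs_det_orthogonal_matrix[OF U] by simp
    have UL: "(\<lambda>x. U *v x) ` L \<in> lmeasurable" "0 < measure lebesgue ((\<lambda>x. U *v x) ` L)"
      using lmeasurable_matrix_image[OF L(1)] L(2) by (simp_all add: UL_measure)
    have pull: "(\<lambda>x. B *v x + w) ` (\<lambda>x. U *v x) ` L = (\<lambda>x. (B ** U) *v x + w) ` L" for B w
      by (simp add: image_image matrix_vector_mul_assoc)
    \<comment> \<open>Undoing the rotation first makes \<open>A'\<close> act on \<open>U L\<close>
      as \<open>A\<close> acts on \<open>L\<close>. Likewise any competitor \<open>B\<close> for
      \<open>U L\<close> becomes the competitor \<open>B ** U\<close> for \<open>L\<close> with the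
      same absolute determinant, so \<open>A'\<close> is maximal.\<close>
    define A' where "A' = A ** transpose U"
    have "A' ** U = A"
      using U by (metis A'_def matrix_mul_assoc matrix_mul_rid orthogonal_matrix_def)
    then have A'_image: "(\<lambda>x. A' *v x + z) ` (\<lambda>x. U *v x) ` L \<subseteq> E"
      using A(2) by (simp add: pull)
    have absU: "\<bar>det (B ** U)\<bar> = \<bar>det B\<bar>" for B
      using abs_det_orthogonal_matrix[OF U] by (simp add: det_mul abs_mult)
    have A'_inv: "invertible A'"
      unfolding A'_def using U by (simp add: invertible_mult[OF A(1)] orthogonal_matrix_invertible)
    have "\<bar>det B\<bar> \<le> \<bar>det A'\<bar>" if "(\<lambda>x. B *v x + w) ` (\<lambda>x. U *v x) ` L \<subseteq> E" for B w
      using max[of "B ** U" w] that absU[of B] absU[of A'] \<open>A' ** U = A\<close> by (simp add: pull)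
    then show ?thesis
      using measure_positive_John_image[OF assms(1) UL A'_inv, folded E, OF A'_image]
        absU[of A'] \<open>A' ** U = A\<close>
      by (simp add: M UL_measure)
  qed
  show ?thesis
    unfolding 1 2 Loewner_position_iff_affine_maximal using 3 by simp
qed

end
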